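(* Let $n\ge1$, $b\in\Delta_n$ and $\varnothing\ne S\subseteq\mathrm{supp}(b)$, and let $$T(b,S)=\{b,\gamma_S(b),\gamma_S^2(b)\}$$ be the corresponding local triangle. Then $$T(b,S)\in\mathrm{AC}_n\quad\Longleftrightarrow\quad |S|\ \text{is odd}.$$
   Context: $\Delta_n=\{i,j,k,e\}^n$ is the set of words $b=b_1b_2\cdots b_n$ of length $n$ in the four symbols $i,j,k,e$. Words multiply coordinatewise as quaternions ($e$ the identity, $i^2=j^2=k^2=-e$, $ij=k$, $jk=i$, $ki=j$, distinct elements of $\{i,j,k\}$ anticommute), with local signs collected into one global sign, giving an element of $\{\pm b: b\in\Delta_n\}$. Put $v(i)=(\cos 210^\circ,\sin 210^\circ)$, $v(j)=(\cos 90^\circ,\sin 90^\circ)$, $v(k)=(\cos 330^\circ,\sin 330^\circ)$, $v(e)=(0,0)$ in $\mathbb R^2$. Fix a real $d_1>0$ and put $d_r=d_1/2^{r-1}$. The centroid map $P:\Delta_n\to\mathbb R^2$ is $$P(b)=\sum_{r=1}^n \sigma_r(b)\,d_r\,v(b_r),\qquad \sigma_r(b)=(-1)^{\#\{s<r:\ b_s=e\}}.$$ $E_n$ is the set of unordered triples $\{b_1,b_2,b_3\}$ of distinct words in $\Delta_n$ such that $P(b_1),P(b_2),P(b_3)$ are the vertices of a nondegenerate equilateral triangle. $\mathrm{AC}_n$ is the set of $T=\{b_1,b_2,b_3\}\in E_n$ with $b_1b_2=-b_2b_1$, $b_1b_3=-b_3b_1$, $b_2b_3=-b_3b_2$. For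 $b\in\Delta_n$ put $\mathrm{supp}(b)=\{r: b_r\ne e\}$. Let $\gamma$ be the permutation $i\mapsto j\mapsto k\mapsto i$, $e\mapsto e$; $\gamma_S(b)$ is obtained by applying $\gamma$ in the coordinates of $S$ and fixing the others. Every $T(b,S)$ with $\varnothing\ne S\subseteq\mathrm{supp}(b)$ is an element of $E_n$. *)

theory Defs
  imports "HOL-Analysis.Analysis"
begin

datatype qsym = QI | QJ | QK | QE

text \<open>Words are lists, so positions are numbered from 0: position \<open>r\<close> here is the
  coordinate \<open>r + 1\<close> in the usual numbering \<open>1, \<dots>, n\<close>.\<close>

type_synonym word = "qsym list"

definition words :: "nat \<Rightarrow> word set" (\<open>\<Delta>\<close>) where
  "\<Delta> n = {b. length b = n}"

text \<open>Quaternion multiplication table; a signed symbol is a pair of a sign \<open>1\<close> or \<open>-1\<close> and a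
  symbol.\<close>

fun qmult :: "qsym \<Rightarrow> qsym \<Rightarrow> int \<times> qsym" where
  "qmult QE y = (1, y)"
| "qmult QI QE = (1, QI)"
| "qmult QJ QE = (1, QJ)"
| "qmult QK QE = (1, QK)"
| "qmult QI QI = (-1, QE)"
| "qmult QJ QJ = (-1, QE)"
| "qmult QK QK = (-1, QE)"
| "qmult QI QJ = (1, QK)"
| "qmult QJ QI = (-1, QK)"
| "qmult QJ QK = (1, QI)"
| "qmult QK QJ = (-1, QI)"
| "qmult QK QI = (1, QJ)"
| "qmult QI QK = (-1, QJ)"

text \<open>Intended for words of equal length; the pair \<open>(s, c)\<close> stands for the signed word \<open>s c\<close>.\<close>

definition word_mult :: "word \<Rightarrow> word \<Rightarrow> int \<times> word" where
  "word_mult b c =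
     (\<Prod>r<length b. fst (qmult (b ! r) (c ! r)), map2 (\<lambda>x y. snd (qmult x y)) b c)"

definition sneg :: "int \<times> word \<Rightarrow> int \<times> word" where
  "sneg p = (- fst p, snd p)"

definition anticommute :: "word \<Rightarrow> word \<Rightarrow> bool" where
  "anticommute b c \<longleftrightarrow> word_mult b c = sneg (word_mult c b)"

fun direction :: "qsym \<Rightarrow> real \<times> real" where
  "direction QI = (cos (210 * pi / 180), sin (210 * pi / 180))"
| "direction QJ = (cos (90 * pi / 180), sin (90 * pi / 180))"
| "direction QK = (cos (330 * pi / 180), sin (330 * pi / 180))"
| "direction QE = (0, 0)"

definition orient :: "word \<Rightarrow> nat \<Rightarrow> real" where
  "orient b r = (-1) ^ card {s. s < r \<and> b ! s = QE}"

text \<open>The parameter \<open>d\<close> is the first step length \<open>d\<^sub>1\<close>; numbering from 0 turns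
  \<open>d\<^sub>r = d\<^sub>1 / 2^(r-1)\<close> into \<open>d / 2^r\<close>.\<close>

definition centroid :: "real \<Rightarrow> word \<Rightarrow> real \<times> real" where
  "centroid d b = (\<Sum>r<length b. (orient b r * (d / 2 ^ r)) *\<^sub>R direction (b ! r))"

definition equilateral :: "real \<times> real \<Rightarrow> real \<times> real \<Rightarrow> real \<times> real \<Rightarrow> bool" where
  "equilateral p q r \<longleftrightarrow> p \<noteq> q \<and> dist p q = dist q r \<and> dist q r = dist r p"

definition equilateral_triples :: "real \<Rightarrow> nat \<Rightarrow> word set set" where
  "equilateral_triples d n =
     {{b1, b2, b3} | b1 b2 b3. b1 \<in> \<Delta> n \<and> b2 \<in> \<Delta> n \<and> b3 \<in> \<Delta> n \<and> distinct [b1, b2, b3] \<and>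
        equilateral (centroid d b1) (centroid d b2) (centroid d b3)}"

definition AC :: "real \<Rightarrow> nat \<Rightarrow> word set set" where
  "AC d n =
     {{b1, b2, b3} | b1 b2 b3. {b1, b2, b3} \<in> equilateral_triples d n \<and>
        anticommute b1 b2 \<and> anticommute b1 b3 \<and> anticommute b2 b3}"

definition supp :: "word \<Rightarrow> nat set" where
  "supp b = {r. r < length b \<and> b ! r \<noteq> QE}"

fun gamma :: "qsym \<Rightarrow> qsym" where
  "gamma QI = QJ"
| "gamma QJ = QK"
| "gamma QK = QI"
| "gamma QE = QE"

definition gamma_on :: "nat set \<Rightarrow> word \<Rightarrow> word" where
  "gamma_on S b = map (\<lambda>r. if r \<in> S then gamma (b ! r) else b ! r) [0..<length b]"

definition local_triangle :: "word \<Rightarrow> nat set \<Rightarrow> word set" where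
  "local_triangle b S = {b, gamma_on S b, (gamma_on S ^^ 2) b}"

end

theory Submission
  imports Defs
begin

text \<open>
  The two conditions in the definition of \<open>AC\<close> separate: a local triangle is always equilateral,
  and the parity of \<open>S\<close> decides anticommutation.

  \<^bold>\<open>Geometry.\<close> The directions of \<open>i\<close>, \<open>j\<close>, \<open>k\<close> are the vertices of an equilateral triangle about
  the origin, and \<open>\<gamma>\<close> acts on them as the rotation \<open>\<rho>\<close> by \<open>-120\<close> degrees. Since \<open>\<gamma>\<close> fixes \<open>e\<close>
  and only \<open>e\<close>, the orientation signs do not change under \<open>\<gamma>\<^sub>S\<close>. Hence the centroids of the three
  words are \<open>c + w\<close>, \<open>c + \<rho> w\<close> and \<open>c + \<rho>\<^sup>2 w\<close>, where \<open>w\<close> collects the steps at positions in \<open>S\<close>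
  and \<open>c\<close> the remaining ones (\<open>centroid_gamma_on\<close>). These points form an equilateral triangle,
  nondegenerate if \<open>w \<noteq> 0\<close>. That \<open>w \<noteq> 0\<close> is a domination argument: the steps in \<open>S\<close> have lengths
  \<open>d / 2^r\<close>, and the longest one exceeds the sum of all the others (\<open>dyadic_sum_nonzero\<close>).

  \<^bold>\<open>Algebra.\<close> The symbols \<open>b\<^sub>r\<close> and \<open>\<gamma> b\<^sub>r\<close> anticommute if \<open>b\<^sub>r \<noteq> e\<close>, and equal symbols commute.
  Swapping the factors of \<open>b \<cdot> \<gamma>\<^sub>S(b)\<close> therefore multiplies the product by \<open>(-1)^|S|\<close>
  (\<open>anticommute_gamma_on\<close>). As \<open>\<gamma>\<^sub>S\<close> has order three and preserves supports, this one computation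
  covers all three sides of the triangle.
\<close>

section \<open>The local rotation of words\<close>

lemma length_gamma_on [simp]: "length (gamma_on S b) = length b"
  by (simp add: gamma_on_def)

lemma gamma_on_nth:
  "r < length b \<Longrightarrow> gamma_on S b ! r = (if r \<in> S then gamma (b ! r) else b ! r)"
  by (simp add: gamma_on_def)

lemma gamma_eq_QE_iff [simp]: "gamma x = QE \<longleftrightarrow> x = QE"
  by (cases x) auto

lemma gamma_cubed [simp]: "gamma (gamma (gamma x)) = x"
  by (cases x) auto

lemma supp_gamma_on [simp]: "supp (gamma_on S b) = supp b"
  by (auto simp: supp_def gamma_on_nth split: if_splits)

lemma gamma_on_cubed [simp]: "gamma_on S (gamma_on S (gamma_on S b)) = b"
  by (rule nth_equalityI) (auto simp: gamma_on_nth)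

lemma orient_gamma_on:
  assumes "r < length b"
  shows "orient (gamma_on S b) r = orient b r"
proof -
  have "{s. s < r \<and> gamma_on S b ! s = QE} = {s. s < r \<and> b ! s = QE}"
    using assms by (auto simp: gamma_on_nth split: if_splits)
  then show ?thesis
    by (simp add: orient_def)
qed

section \<open>Local triangles are equilateral\<close>

text \<open>The rotation of the plane by \<open>-120\<close> degrees, which takes the direction \<open>210\<close> to \<open>90\<close>, \<open>90\<close>
  to \<open>330\<close> and \<open>330\<close> to \<open>210\<close> degrees.\<close>

definition rot :: "real \<times> real \<Rightarrow> real \<times> real" where
  "rot p = (- fst p / 2 + sqrt 3 / 2 * snd p, - (sqrt 3 / 2 * fst p) - snd p / 2)"

lemma linear_rot: "linear rot"
  by (rule linearI) (auto simp: rot_def field_simps)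

lemma norm_rot: "norm (rot p) = norm p"
proof -
  have "(- fst p / 2 + sqrt 3 / 2 * snd p)\<^sup>2 + (- (sqrt 3 / 2 * fst p) - snd p / 2)\<^sup>2
      = (1 / 4 + (sqrt 3)\<^sup>2 / 4) * ((fst p)\<^sup>2 + (snd p)\<^sup>2)"
    by (simp add: power2_eq_square algebra_simps)
  then show ?thesis
    by (simp add: rot_def norm_prod_def)
qed

lemma rot_cubed: "rot (rot (rot p)) = p"
proof -
  have s: "sqrt 3 * (sqrt 3 * x) = 3 * x" for x :: real
    by (simp flip: mult.assoc)
  show ?thesis
    by (rule prod_eqI) (simp_all add: rot_def field_simps s)
qed

lemma rot_fixed_imp_zero:
  assumes "rot p = p"
  shows "p = 0"
proof -
  have x: "sqrt 3 * snd p = 3 * fst p" and y: "sqrt 3 * fst p = - 3 * snd p"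
    using assms by (auto simp: rot_def prod_eq_iff)
  have "3 * fst p = sqrt 3 * (sqrt 3 * fst p)"
    by (simp flip: mult.assoc)
  also have "\<dots> = - 3 * (sqrt 3 * snd p)"
    unfolding y by simp
  also have "\<dots> = - 9 * fst p"
    unfolding x by simp
  finally have "fst p = 0"
    by simp
  with y show ?thesis
    by (simp add: prod_eq_iff)
qed

lemma direction_gamma: "direction (gamma x) = rot (direction x)"
proof -
  have angles: "210 * pi / 180 = pi / 6 + pi" "90 * pi / 180 = pi / 2"
    "330 * pi / 180 = 2 * pi - pi / 6"
    by simp_all
  have i: "direction QI = (- sqrt 3 / 2, - 1 / 2)" and j: "direction QJ = (0, 1)"
    and k: "direction QK = (sqrt 3 / 2, - 1 / 2)"
    unfolding direction.simps angles cos_periodic_pi sin_periodic_pi cos_2pi_minus sin_2pi_minus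
    by (simp_all add: cos_30 sin_30)
  show ?thesis
    by (cases x)
      (simp_all add: i j k rot_def del: direction.simps(1-3))
qed

lemma norm_direction: "x \<noteq> QE \<Longrightarrow> norm (direction x) = 1"
  by (cases x) (auto simp: norm_prod_def simp del: sin_cos_squared_add)

text \<open>The rotation preserves lengths and has order three, so it permutes the sides of the triangle
  cyclically.\<close>

lemma equilateral_rot_orbit:
  assumes "w \<noteq> 0"
  shows "equilateral (c + w) (c + rot w) (c + rot (rot w))"
proof -
  have iso: "dist (rot x) (rot y) = dist x y" for x y
    by (metis dist_norm linear_diff linear_rot norm_rot)
  have "w \<noteq> rot w"
    using assms rot_fixed_imp_zero by metis
  moreover have "dist w (rot w) = dist (rot w) (rot (rot w))"
    by (simp add: iso)
  moreover have "dist (rot w) (rot (rot w)) = dist (rot (rot w)) w"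
    using iso[of "rot w" "rot (rot w)"] by (simp add: rot_cubed)
  ultimately show ?thesis
    by (simp add: equilateral_def)
qed

lemma equilateral_imp_distinct:
  "equilateral p q r \<Longrightarrow> p \<noteq> q \<and> q \<noteq> r \<and> p \<noteq> r"
  by (auto simp: equilateral_def)

definition partial_centroid :: "real \<Rightarrow> nat set \<Rightarrow> word \<Rightarrow> real \<times> real" where
  "partial_centroid d A b = (\<Sum>r\<in>A. (orient b r * (d / 2 ^ r)) *\<^sub>R direction (b ! r))"

lemma centroid_split:
  assumes "S \<subseteq> {..<length b}"
  shows "centroid d b = partial_centroid d ({..<length b} - S) b + partial_centroid d S b"
  unfolding centroid_def partial_centroid_def
  using assms by (simp add: sum.subset_diff)

lemma partial_centroid_gamma_on_outside:
  assumes "A \<subseteq> {..<length b}" and "A \<inter> S = {}"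
  shows "partial_centroid d A (gamma_on S b) = partial_centroid d A b"
  unfolding partial_centroid_def
proof (rule sum.cong)
  fix r assume "r \<in> A"
  then have "r < length b" "r \<notin> S"
    using assms by auto
  then show "(orient (gamma_on S b) r * (d / 2 ^ r)) *\<^sub>R direction (gamma_on S b ! r)
      = (orient b r * (d / 2 ^ r)) *\<^sub>R direction (b ! r)"
    by (simp add: orient_gamma_on gamma_on_nth)
qed simp

lemma partial_centroid_gamma_on_inside:
  assumes "S \<subseteq> {..<length b}"
  shows "partial_centroid d S (gamma_on S b) = rot (partial_centroid d S b)"
  unfolding partial_centroid_def linear_sum[OF linear_rot] linear_scale[OF linear_rot]
proof (rule sum.cong)
  fix r assume "r \<in> S"
  then have "r < length b"
    using assms by auto
  then show "(orient (gamma_on S b) r * (d / 2 ^ r)) *\<^sub>R direction (gamma_on S b ! r)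
      = (orient b r * (d / 2 ^ r)) *\<^sub>R rot (direction (b ! r))"
    using \<open>r \<in> S\<close> by (simp add: orient_gamma_on gamma_on_nth direction_gamma)
qed simp

lemma centroid_gamma_on:
  assumes "S \<subseteq> {..<length b}"
  shows "centroid d (gamma_on S b)
    = partial_centroid d ({..<length b} - S) b + rot (partial_centroid d S b)"
  using assms centroid_split[of S "gamma_on S b" d]
  by (simp add: partial_centroid_gamma_on_inside
      partial_centroid_gamma_on_outside[of "{..<length b} - S" b S d] Diff_Int_distrib2)

text \<open>The longest vector cannot be cancelled: a finite tail of \<open>\<Sum> d / 2^r\<close> beyond position \<open>m\<close>
  stays strictly below \<open>d / 2^m\<close>.\<close>

lemma dyadic_sum_nonzero:
  fixes a :: "nat \<Rightarrow> 'a::real_normed_vector"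
  assumes "finite S" and "S \<noteq> {}" and "d > 0"
    and len: "\<And>r. r \<in> S \<Longrightarrow> norm (a r) = d / 2 ^ r"
  shows "sum a S \<noteq> 0"
proof
  assume zero: "sum a S = 0"
  define m where "m = Min S"
  define N where "N = Max S"
  have m: "m \<in> S" and "m \<le> N" and sub: "S - {m} \<subseteq> {m<..N}"
    using assms(1,2) by (auto simp: m_def N_def order.not_eq_order_implies_strict)
  have tail: "(\<Sum>r\<in>{m<..N}. d / 2 ^ r) = d / 2 ^ m - d / 2 ^ N"
    using \<open>m \<le> N\<close>
  proof (induction N rule: dec_induct)
    case (step k)
    have "{m<..Suc k} = insert (Suc k) {m<..k}"
      using step(1) by auto
    then have "(\<Sum>r\<in>{m<..Suc k}. d / 2 ^ r) = d / 2 ^ Suc k + (d / 2 ^ m - d / 2 ^ k)"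
      using step.IH by simp
    then show ?case
      by (simp add: field_simps)
  qed simp
  have "a m = - sum a (S - {m})"
    using zero assms(1) m by (simp add: sum.remove eq_neg_iff_add_eq_0)
  then have "d / 2 ^ m = norm (sum a (S - {m}))"
    using len[OF m] by simp
  also have "\<dots> \<le> (\<Sum>r\<in>S - {m}. d / 2 ^ r)"
    using len by (intro order_trans[OF norm_sum] sum_mono) auto
  also have "\<dots> \<le> (\<Sum>r\<in>{m<..N}. d / 2 ^ r)"
    using sub \<open>d > 0\<close> by (intro sum_mono2) auto
  also have "\<dots> < d / 2 ^ m"
    using tail \<open>d > 0\<close> by simp
  finally show False
    by simp
qed

lemma partial_centroid_nonzero:
  assumes "d > 0" and "S \<noteq> {}" and "S \<subseteq> supp b"
  shows "partial_centroid d S b \<noteq> 0"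
  unfolding partial_centroid_def
proof (rule dyadic_sum_nonzero)
  show "finite S"
    using assms(3) by (rule finite_subset) (simp add: supp_def)
  fix r assume "r \<in> S"
  then have "b ! r \<noteq> QE"
    using assms(3) by (auto simp: supp_def)
  then show "norm ((orient b r * (d / 2 ^ r)) *\<^sub>R direction (b ! r)) = d / 2 ^ r"
    using \<open>d > 0\<close> by (simp add: norm_direction orient_def abs_mult power_abs)
qed (use assms in auto)

lemma local_triangle_equilateral:
  assumes "d > 0" and "b \<in> \<Delta> n" and "S \<noteq> {}" and "S \<subseteq> supp b"
  shows "local_triangle b S \<in> equilateral_triples d n"
proof -
  let ?b1 = "gamma_on S b" and ?b2 = "gamma_on S (gamma_on S b)"
  have S: "S \<subseteq> {..<length b}"
    using assms(4) by (auto simp: supp_def)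
  have "centroid d ?b2
      = partial_centroid d ({..<length b} - S) b + rot (rot (partial_centroid d S b))"
    using S centroid_gamma_on[of S "gamma_on S b" d]
    by (simp add: partial_centroid_gamma_on_inside
        partial_centroid_gamma_on_outside[of "{..<length b} - S" b S d] Diff_Int_distrib2)
  then have eq: "equilateral (centroid d b) (centroid d ?b1) (centroid d ?b2)"
    using equilateral_rot_orbit partial_centroid_nonzero assms S
    by (metis centroid_gamma_on centroid_split)
  have "distinct [b, ?b1, ?b2]"
    using equilateral_imp_distinct[OF eq] by auto
  moreover have "b \<in> \<Delta> n" "?b1 \<in> \<Delta> n" "?b2 \<in> \<Delta> n"
    using assms(2) by (simp_all add: words_def)
  moreover have "local_triangle b S = {b, ?b1, ?b2}"
    by (simp add: local_triangle_def numeral_2_eq_2)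
  ultimately show ?thesis
    using eq unfolding equilateral_triples_def by blast
qed

section \<open>Anticommutation and parity\<close>

lemma sneg_sneg [simp]: "sneg (sneg p) = p"
  by (simp add: sneg_def)

lemma anticommute_sym: "anticommute b c \<longleftrightarrow> anticommute c b"
  unfolding anticommute_def by (metis sneg_sneg)

lemma fst_qmult_nonzero [simp]: "fst (qmult x y) \<noteq> 0"
  by (cases x; cases y) auto

lemma qmult_gamma:
  "x \<noteq> QE \<Longrightarrow> qmult x (gamma x) = (- fst (qmult (gamma x) x), snd (qmult (gamma x) x))"
  by (cases x) auto

text \<open>The underlying words of the two products agree, so only the signs matter; each position in
  \<open>S\<close> contributes one factor \<open>-1\<close> when the factors are swapped.\<close>

lemma anticommute_gamma_on:
  assumes "S \<subseteq> supp b"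
  shows "anticommute b (gamma_on S b) \<longleftrightarrow> odd (card S)"
proof -
  let ?c = "gamma_on S b"
  let ?s = "\<Prod>r<length b. fst (qmult (?c ! r) (b ! r))"
  have S: "S \<subseteq> {..<length b}"
    using assms by (auto simp: supp_def)
  have nonE: "b ! r \<noteq> QE" if "r \<in> S" for r
    using assms that by (auto simp: supp_def)
  have "(\<Prod>r<length b. fst (qmult (b ! r) (?c ! r)))
      = (\<Prod>r<length b. (if r \<in> S then -1 else 1) * fst (qmult (?c ! r) (b ! r)))"
    by (rule prod.cong) (auto simp: gamma_on_nth qmult_gamma nonE)
  also have "\<dots> = (\<Prod>r<length b. if r \<in> S then -1 else 1) * ?s"
    by (rule prod.distrib)
  also have "(\<Prod>r<length b. if r \<in> S then -1 else 1 :: int) = (-1) ^ card S"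
    using S by (simp add: prod.If_cases Int_absorb1)
  finally have sign: "(\<Prod>r<length b. fst (qmult (b ! r) (?c ! r))) = (-1) ^ card S * ?s" .
  have word: "map2 (\<lambda>x y. snd (qmult x y)) b ?c = map2 (\<lambda>x y. snd (qmult x y)) ?c b"
    by (rule nth_equalityI) (auto simp: gamma_on_nth qmult_gamma nonE)
  have "anticommute b ?c \<longleftrightarrow> (-1) ^ card S * ?s = - ?s"
    by (simp add: anticommute_def word_mult_def sneg_def sign word)
  also have "\<dots> \<longleftrightarrow> odd (card S)"
  proof (cases "even (card S)")
    case True
    have "?s \<noteq> 0"
      by simp
    then show ?thesis
      using True by (simp del: prod_zero_iff)
  qed simp
  finally show ?thesis .
qed

section \<open>The parity criterion\<close>

theorem theorem10p6:
  fixes d :: real and n :: nat and b :: word and S :: "nat set"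
  assumes "d > 0" and "n \<ge> 1" and "b \<in> \<Delta> n" and "S \<noteq> {}" and "S \<subseteq> supp b"
  shows "local_triangle b S \<in> AC d n \<longleftrightarrow> odd (card S)"
proof
  let ?b1 = "gamma_on S b" and ?b2 = "gamma_on S (gamma_on S b)"
  have tri: "local_triangle b S = {b, ?b1, ?b2}"
    by (simp add: local_triangle_def numeral_2_eq_2)
  have equi: "local_triangle b S \<in> equilateral_triples d n"
    using assms by (intro local_triangle_equilateral)
  {
    assume "local_triangle b S \<in> AC d n"
    \<comment> \<open>The anticommuting triple may list the vertices in any order; as anticommutation is
      symmetric, \<open>b\<close> and \<open>\<gamma>\<^sub>S(b)\<close> anticommute in each case, provided that they differ.\<close>
    then obtain c1 c2 c3 where set: "{b, ?b1, ?b2} = {c1, c2, c3}"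
      and ac: "anticommute c1 c2" "anticommute c1 c3" "anticommute c2 c3"
      unfolding AC_def tri by auto
    obtain r where "r \<in> S" "r < length b" "b ! r \<noteq> QE"
      using assms(4,5) by (auto simp: supp_def)
    then have "?b1 ! r \<noteq> b ! r"
      by (cases "b ! r") (auto simp: gamma_on_nth)
    then have "b \<noteq> ?b1"
      by auto
    moreover have "b \<in> {c1, c2, c3}" "?b1 \<in> {c1, c2, c3}"
      using set by blast+
    ultimately have "anticommute b ?b1"
      using ac anticommute_sym by auto
    then show "odd (card S)"
      using anticommute_gamma_on assms(5) by simp
  next
    assume odd: "odd (card S)"
    have "anticommute b ?b1" "anticommute ?b1 ?b2"
      using odd assms(5) by (simp_all add: anticommute_gamma_on)
    \<comment> \<open>The third side closes the cycle: \<open>\<gamma>\<^sub>S\<close> takes the last vertex back to \<open>b\<close>.\<close>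
    moreover have "anticommute b ?b2"
      using odd assms(5) anticommute_gamma_on[of S ?b2] by (simp add: anticommute_sym)
    ultimately show "local_triangle b S \<in> AC d n"
      using equi unfolding AC_def tri by blast
  }
qed

end
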